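(* Let $k\ge2$. The orbits of rowmotion on the three-leaf tree $T_k$ can be partitioned by length into three sets $\mathcal{S}$, $\mathcal{M}$ and $\mathcal{L}$ with the following properties. (a) $\#\mathcal{S}=k(k-1)$, $\#\mathcal{M}=k-1$, $\#\mathcal{L}=1$, and $$\#\mathcal{O}=\begin{cases}k&\text{if }\mathcal{O}\in\mathcal{S},\\2k&\text{if }\mathcal{O}\in\mathcal{M},\\3k&\text{if }\mathcal{O}\in\mathcal{L}.\end{cases}$$ (b) $$\chi(\mathcal{O})=\begin{cases}3k-3&\text{if }\mathcal{O}\in\mathcal{S},\\5k-4&\text{if }\mathcal{O}\in\mathcal{M},\\6k-4&\text{if }\mathcal{O}\in\mathcal{L}.\end{cases}$$ Thus $\chi$ is homometric but not homomesic. (c) $$\hat\chi(\mathcal{O})=\begin{cases}\frac72k^2-\frac32k&\text{if }\mathcal{O}\in\mathcal{S},\\[1ex]\frac{11}2k^2-\frac52k&\text{if }\mathcal{O}\in\mathcal{M},\\[1ex]6k^2-3k&\text{if }\mathcal{O}\in\mathcal{L}.\end{cases}$$ Thus $\hat\chi$ is homometric but not homomesic.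
   Context: For a finite poset $P$, let $\mathcal{A}(P)$ be its set of antichains, and for $Q\subseteq P$ let $Q{\downarrow}=\{x\in P: x\le y\text{ for some }y\in Q\}$. Rowmotion on antichains is the bijection $\rho(A)=\min\{x\in P: x\notin A{\downarrow}\}$ of $\mathcal{A}(P)$; rowmotion on lower order ideals is $\hat\rho(L)=\rho(\max L){\downarrow}$. The map $A\mapsto A{\downarrow}$ carries antichain orbits to ideal orbits. Orbits $\mathcal{O}$ are antichain orbits; $\chi(\mathcal{O})=\sum_{A\in\mathcal{O}}\#A$ and $\hat\chi(\mathcal{O})=\sum_{A\in\mathcal{O}}\#(A{\downarrow})$. A statistic $\mathrm{st}$ is homomesic if $\mathrm{st}(\mathcal{O})/\#\mathcal{O}$ is the same constant for all orbits $\mathcal{O}$, and homometric if $\mathrm{st}(\mathcal{O}_1)=\mathrm{st}(\mathcal{O}_2)$ for any two orbits with $\#\mathcal{O}_1=\#\mathcal{O}_2$. The tree $T_k$ is the poset with unique minimal element and three maximal elements (leaves) $1,2,3$ which is the disjoint union of five chains: a chain $B_{[3]}$ of $k$ elements (those below all three leaves), a chain $B_{[2]}$ of $k$ elements (those below exactly leaves $1,2$), and chains $B_1,B_2,B_3$ of $k-1$ elements each, where $B_i$ consists of the elements below exactly the leaf $i$ (including $i$ itself). The minimum of $B_{[3]}$ is the root; the maximum of $B_{[3]}$ is covered by exactly the minima of $B_{[2]}$ and of $B_3$; the maximum of $B_{[2]}$ is covered by exactly the minima of $B_1$ and of $B_2$. *)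

theory Defs
  imports Complex_Main "HOL-Combinatorics.Orbits"
begin

section \<open>Rowmotion on a finite poset\<close>

text \<open>
  A finite poset is given by a finite carrier \<open>P\<close> and its order relation \<open>r\<close>, with
  \<open>partial_order_on P r\<close>; \<open>(x, y) \<in> r\<close> means \<open>x \<le> y\<close>.
\<close>

definition antichains :: "'a set \<Rightarrow> 'a rel \<Rightarrow> 'a set set" where
  "antichains P r = {A. A \<subseteq> P \<and> (\<forall>x\<in>A. \<forall>y\<in>A. (x, y) \<in> r \<longrightarrow> x = y)}"

definition down :: "'a set \<Rightarrow> 'a rel \<Rightarrow> 'a set \<Rightarrow> 'a set" where
  "down P r Q = {x \<in> P. \<exists>y\<in>Q. (x, y) \<in> r}"

definition minimals :: "'a rel \<Rightarrow> 'a set \<Rightarrow> 'a set" where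
  "minimals r Q = {x \<in> Q. \<forall>y\<in>Q. (y, x) \<in> r \<longrightarrow> y = x}"

definition rowmotion :: "'a set \<Rightarrow> 'a rel \<Rightarrow> 'a set \<Rightarrow> 'a set" where
  "rowmotion P r A = minimals r {x \<in> P. x \<notin> down P r A}"

text \<open>
  \<^const>\<open>orbit\<close> is the forward orbit \<open>{f a, f (f a), \<dots>}\<close>. It contains \<open>a\<close> itself here,
  because rowmotion permutes the finite set of antichains; see \<open>rowmotion_bij\<close> and
  \<open>self_in_rowmotion_orbit\<close> below.
\<close>

definition rowmotion_orbits :: "'a set \<Rightarrow> 'a rel \<Rightarrow> 'a set set set" where
  "rowmotion_orbits P r = (\<lambda>A. orbit (rowmotion P r) A) ` antichains P r"

definition chi :: "'a set set \<Rightarrow> real" where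
  "chi \<O> = (\<Sum>A\<in>\<O>. real (card A))"

definition chi_hat :: "'a set \<Rightarrow> 'a rel \<Rightarrow> 'a set set \<Rightarrow> real" where
  "chi_hat P r \<O> = (\<Sum>A\<in>\<O>. real (card (down P r A)))"

definition homomesic :: "'a set \<Rightarrow> 'a rel \<Rightarrow> ('a set set \<Rightarrow> real) \<Rightarrow> bool" where
  "homomesic P r st \<longleftrightarrow> (\<exists>c. \<forall>\<O>\<in>rowmotion_orbits P r. st \<O> / real (card \<O>) = c)"

definition homometric :: "'a set \<Rightarrow> 'a rel \<Rightarrow> ('a set set \<Rightarrow> real) \<Rightarrow> bool" where
  "homometric P r st \<longleftrightarrow>
     (\<forall>\<O>\<^sub>1\<in>rowmotion_orbits P r. \<forall>\<O>\<^sub>2\<in>rowmotion_orbits P r.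
        card \<O>\<^sub>1 = card \<O>\<^sub>2 \<longrightarrow> st \<O>\<^sub>1 = st \<O>\<^sub>2)"

lemma rowmotion_in_antichains: "rowmotion P r A \<in> antichains P r"
  by (auto simp: rowmotion_def minimals_def antichains_def)

lemma finite_antichains: "finite P \<Longrightarrow> finite (antichains P r)"
  by (rule finite_subset[of _ "Pow P"]) (auto simp: antichains_def)

lemma minimal_below:
  assumes fin: "finite P" and po: "partial_order_on P r" and "U \<subseteq> P" "x \<in> U"
  shows "\<exists>m\<in>minimals r U. (m, x) \<in> r"
proof -
  have refl: "refl_on P r" and tr: "trans r" and an: "antisym r"
    using po by (auto simp: partial_order_on_def preorder_on_def)
  define V where "V = {y \<in> U. (y, x) \<in> r}"
  define s where "s = {(a, b). (a, b) \<in> r \<and> a \<noteq> b \<and> a \<in> V \<and> b \<in> V}"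
  have "V \<subseteq> P"
    using \<open>U \<subseteq> P\<close> by (auto simp: V_def)
  then have "finite V"
    using fin by (rule finite_subset)
  then have "finite (V \<times> V)"
    by simp
  moreover have "s \<subseteq> V \<times> V"
    by (auto simp: s_def)
  ultimately have "finite s"
    by (rule finite_subset[rotated])
  moreover have "trans s"
    using tr an unfolding trans_def antisym_def s_def by blast
  then have "acyclic s"
    by (simp add: acyclic_def s_def)
  ultimately have "wf s"
    by (rule finite_acyclic_wf)
  moreover have "x \<in> V"
    using assms refl by (auto simp: V_def refl_on_def)
  ultimately obtain m where m: "m \<in> V" "\<And>y. (y, m) \<in> s \<Longrightarrow> y \<notin> V"
    by (metis wfE_min)
  have "m \<in> minimals r U"
    using m tr unfolding minimals_def V_def s_def trans_def by blast
  then show ?thesis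
    using m by (auto simp: V_def)
qed

lemma down_eq_of_rowmotion:
  assumes fin: "finite P" and po: "partial_order_on P r" and A: "A \<in> antichains P r"
  shows "down P r A = {x \<in> P. \<not> (\<exists>m\<in>rowmotion P r A. (m, x) \<in> r)}" (is "?L = ?R")
proof
  have tr: "trans r"
    using po by (auto simp: partial_order_on_def preorder_on_def)
  show "?L \<subseteq> ?R"
    using tr unfolding rowmotion_def minimals_def down_def trans_def by blast
  show "?R \<subseteq> ?L"
    using minimal_below[OF fin po, of "{x \<in> P. x \<notin> down P r A}"]
    unfolding rowmotion_def by blast
qed

lemma antichain_of_down:
  assumes po: "partial_order_on P r" and A: "A \<in> antichains P r"
  shows "A = {x \<in> down P r A. \<forall>y\<in>down P r A. (x, y) \<in> r \<longrightarrow> y = x}" (is "A = ?R")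
proof
  have refl: "refl_on P r" and tr: "trans r" and an: "antisym r"
    using po by (auto simp: partial_order_on_def preorder_on_def)
  have sub: "A \<subseteq> down P r A"
    using A refl by (auto simp: antichains_def down_def refl_on_def)
  show "A \<subseteq> ?R"
  proof
    fix x assume x: "x \<in> A"
    have "y = x" if "y \<in> down P r A" "(x, y) \<in> r" for y
    proof -
      obtain z where z: "z \<in> A" "(y, z) \<in> r"
        using \<open>y \<in> down P r A\<close> by (auto simp: down_def)
      then have "(x, z) \<in> r"
        using \<open>(x, y) \<in> r\<close> tr by (meson transE)
      then have "x = z"
        using A x z by (auto simp: antichains_def)
      then show ?thesis
        using z \<open>(x, y) \<in> r\<close> an by (meson antisymD)
    qed
    then show "x \<in> ?R"
      using x sub by blast
  qed
  show "?R \<subseteq> A"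
    using sub by (auto simp: down_def)
qed

lemma rowmotion_bij:
  assumes fin: "finite P" and po: "partial_order_on P r"
  shows "bij_betw (rowmotion P r) (antichains P r) (antichains P r)"
proof -
  have "inj_on (rowmotion P r) (antichains P r)"
  proof (rule inj_onI)
    fix A B
    assume AB: "A \<in> antichains P r" "B \<in> antichains P r" "rowmotion P r A = rowmotion P r B"
    then have "down P r A = down P r B"
      by (simp add: down_eq_of_rowmotion[OF fin po])
    then show "A = B"
      using antichain_of_down[OF po AB(1)] antichain_of_down[OF po AB(2)] by simp
  qed
  then show ?thesis
    using endo_inj_surj[OF finite_antichains[OF fin]] rowmotion_in_antichains
    unfolding bij_betw_def by (metis image_subsetI)
qed

lemma self_in_rowmotion_orbit:
  assumes fin: "finite P" and po: "partial_order_on P r" and A: "A \<in> antichains P r"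
  shows "A \<in> orbit (rowmotion P r) A"
proof -
  let ?f = "rowmotion P r" and ?O = "orbit (rowmotion P r) A"
  have sub: "?O \<subseteq> antichains P r"
    by (auto elim: orbit.cases simp: rowmotion_in_antichains)
  then have fO: "finite ?O"
    using finite_antichains[OF fin] finite_subset by blast
  have "inj_on ?f (insert A ?O)"
    using rowmotion_bij[OF fin po] A sub unfolding bij_betw_def
    by (meson inj_on_subset insert_subset)
  then have "card (insert A ?O) = card (?f ` insert A ?O)"
    by (rule card_image[symmetric])
  also have "\<dots> \<le> card ?O"
    by (rule card_mono[OF fO]) (auto intro: orbit.intros)
  finally show ?thesis
    using fO by (metis card_insert_disjoint not_less_eq_eq order_refl)
qed

section \<open>The three-leaf tree\<close>

text \<open>
  The constructors are the five chains, named by the leaves above them: \<open>B123\<close> is the chain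
  $B_{[3]}$ and \<open>B12\<close> is the chain $B_{[2]}$. The argument is the position in the chain, counted
  from \<open>0\<close> at the bottom. The lemmas below give the minimum, the leaves, the leaves above each
  element and the cover relation.
\<close>

datatype node = B123 nat | B12 nat | B1 nat | B2 nat | B3 nat

definition tree :: "nat \<Rightarrow> node set" where
  "tree k = B123 ` {..<k} \<union> B12 ` {..<k} \<union> B1 ` {..<k - 1} \<union> B2 ` {..<k - 1} \<union> B3 ` {..<k - 1}"

fun node_le :: "node \<Rightarrow> node \<Rightarrow> bool" where
  "node_le (B123 i) (B123 j) \<longleftrightarrow> i \<le> j"
| "node_le (B123 i) _ \<longleftrightarrow> True"
| "node_le (B12 i) (B12 j) \<longleftrightarrow> i \<le> j"
| "node_le (B12 i) (B1 j) \<longleftrightarrow> True"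
| "node_le (B12 i) (B2 j) \<longleftrightarrow> True"
| "node_le (B1 i) (B1 j) \<longleftrightarrow> i \<le> j"
| "node_le (B2 i) (B2 j) \<longleftrightarrow> i \<le> j"
| "node_le (B3 i) (B3 j) \<longleftrightarrow> i \<le> j"
| "node_le _ _ \<longleftrightarrow> False"

definition tree_order :: "nat \<Rightarrow> node rel" where
  "tree_order k = {(x, y). x \<in> tree k \<and> y \<in> tree k \<and> node_le x y}"

definition covered_by :: "'a rel \<Rightarrow> 'a \<Rightarrow> 'a \<Rightarrow> bool" where
  "covered_by r x y \<longleftrightarrow>
     (x, y) \<in> r \<and> x \<noteq> y \<and> (\<forall>z. (x, z) \<in> r \<and> (z, y) \<in> r \<longrightarrow> z = x \<or> z = y)"

lemma mem_tree [simp]: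
  "B123 i \<in> tree k \<longleftrightarrow> i < k" "B12 i \<in> tree k \<longleftrightarrow> i < k"
  "B1 i \<in> tree k \<longleftrightarrow> i < k - 1" "B2 i \<in> tree k \<longleftrightarrow> i < k - 1" "B3 i \<in> tree k \<longleftrightarrow> i < k - 1"
  by (auto simp: tree_def)

lemma finite_tree: "finite (tree k)"
  by (simp add: tree_def)

lemma node_le_refl: "node_le x x"
  by (cases x) auto

lemma node_le_trans: "node_le x y \<Longrightarrow> node_le y z \<Longrightarrow> node_le x z"
  by (cases x; cases y; cases z) auto

lemma node_le_antisym: "node_le x y \<Longrightarrow> node_le y x \<Longrightarrow> x = y"
  by (cases x; cases y) auto

lemma partial_order_on_tree: "partial_order_on (tree k) (tree_order k)"
  by (auto simp: partial_order_on_def preorder_on_def refl_on_def tree_order_def node_le_refl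
      intro!: transI antisymI intro: node_le_trans node_le_antisym)

lemma tree_minimum:
  assumes "k \<ge> 2" "x \<in> tree k"
  shows "(B123 0, x) \<in> tree_order k"
  using assms by (cases x) (auto simp: tree_order_def)

lemma tree_maximal_iff:
  assumes "k \<ge> 2" "x \<in> tree k"
  shows "(\<forall>y. (x, y) \<in> tree_order k \<longrightarrow> y = x) \<longleftrightarrow> x \<in> {B1 (k - 2), B2 (k - 2), B3 (k - 2)}"
    (is "?mx \<longleftrightarrow> _")
proof
  assume mx: ?mx
  then have "node_le x (c (k - 2)) \<Longrightarrow> c (k - 2) = x" if "c \<in> {B1, B2, B3}" for c
    using that assms by (auto simp: tree_order_def)
  from this[of B1] this[of B2] this[of B3] show "x \<in> {B1 (k - 2), B2 (k - 2), B3 (k - 2)}"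
    using assms by (cases x) (auto, linarith+)
next
  assume "x \<in> {B1 (k - 2), B2 (k - 2), B3 (k - 2)}"
  moreover have "y = x" if "(x, y) \<in> tree_order k" for y
    using that calculation by (cases y) (auto simp: tree_order_def)
  ultimately show ?mx
    by blast
qed

lemma tree_below_leaves:
  assumes "k \<ge> 2" "x \<in> tree k"
  shows "(x, B1 (k - 2)) \<in> tree_order k \<longleftrightarrow> x \<in> range B123 \<union> range B12 \<union> range B1"
    and "(x, B2 (k - 2)) \<in> tree_order k \<longleftrightarrow> x \<in> range B123 \<union> range B12 \<union> range B2"
    and "(x, B3 (k - 2)) \<in> tree_order k \<longleftrightarrow> x \<in> range B123 \<union> range B3"
  using assms by (cases x; auto simp: tree_order_def)+

lemma tree_covers:
  assumes "k \<ge> 2" "x \<in> tree k" "y \<in> tree k"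
  shows "covered_by (tree_order k) x y \<longleftrightarrow>
    (\<exists>c\<in>{B123, B12, B1, B2, B3}. \<exists>i. x = c i \<and> y = c (Suc i)) \<or>
    (x = B123 (k - 1) \<and> (y = B12 0 \<or> y = B3 0)) \<or>
    (x = B12 (k - 1) \<and> (y = B1 0 \<or> y = B2 0))" (is "_ \<longleftrightarrow> ?R")
proof
  assume "covered_by (tree_order k) x y"
  then have le: "node_le x y" "x \<noteq> y"
    and between: "\<And>z. z \<in> tree k \<Longrightarrow> node_le x z \<Longrightarrow> node_le z y \<Longrightarrow> z = x \<or> z = y"
    using assms by (auto simp: covered_by_def tree_order_def)
  have up: "B123 (Suc i) = y \<or> k \<le> Suc i" if "x = B123 i" "node_le (B123 (Suc i)) y" for i
    using that between[of "B123 (Suc i)"] by auto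
  have up': "B12 (Suc i) = y \<or> k \<le> Suc i" if "x = B12 i" "node_le (B12 (Suc i)) y" for i
    using that between[of "B12 (Suc i)"] by auto
  have up1: "c (Suc i) = y \<or> k - 1 \<le> Suc i"
    if "c \<in> {B1, B2, B3}" "x = c i" "node_le (c (Suc i)) y" for c i
    using that between[of "c (Suc i)"] by auto
  show ?R
    using le assms up up' up1[of B1] up1[of B2] up1[of B3]
      between[of "B12 0"] between[of "B1 0"] between[of "B2 0"] between[of "B3 0"]
    by (cases x; cases y) auto
next
  assume ?R
  moreover have "z = x \<or> z = y" if "z \<in> tree k" "node_le x z" "node_le z y" for z
    using that calculation by (cases z) auto
  ultimately show "covered_by (tree_order k) x y"
    using assms by (auto simp: covered_by_def tree_order_def)
qed

end

theory Submission
  imports Defs "HOL-Number_Theory.Cong"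
begin

text \<open>
  Record an antichain by its position in each of the five chains. Rowmotion fills a chain of the
  generated ideal from the bottom, one element per step, once everything below the chain is in the
  ideal. A full branch \<open>B1\<close>, \<open>B2\<close> or \<open>B3\<close> is empty in the next step; since it has \<open>k - 1\<close> elements,
  its position runs through the residues modulo \<open>k\<close>. In contrast, \<open>B12\<close> and \<open>B123\<close> stay full until
  everything above them is full at the same time: then the chain is emptied too, and refilling it
  takes \<open>k\<close> extra steps. Which of these collapses happen depends only on the constant offsets
  between the residues.

  \<^item> If \<open>B1\<close> and \<open>B2\<close> have different positions, they are never full together and \<open>B12\<close> stays full.
    The offsets \<open>d \<noteq> 0\<close> of \<open>B2\<close> and \<open>e\<close> of \<open>B3\<close> relative to \<open>B1\<close> determine one orbit of length \<open>k\<close>,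
    which gives \<open>k (k - 1)\<close> of them.
  \<^item> If \<open>B1\<close> and \<open>B2\<close> move together, their collapse forces \<open>B12\<close> to be refilled, and this side of the
    tree has period \<open>2 k\<close>. If \<open>B3\<close> has an offset \<open>e \<noteq> 0\<close> modulo \<open>k\<close>, the three branches are never full
    together, so there is one orbit of length \<open>2 k\<close> for each of the \<open>k - 1\<close> values of \<open>e\<close>.
  \<^item> If moreover \<open>e = 0\<close>, the whole tree collapses and the trunk \<open>B123\<close> is refilled as well. This is
    the single orbit of length \<open>3 k\<close>.

  The step rules are \<open>rowmotion_short\<close>, \<open>rowmotion_medium\<close> and \<open>rowmotion_long\<close>; \<open>antichain_cases\<close>
  says that no antichain is left out. Since a residue takes every value once in \<open>k\<close> consecutive
  steps, whatever its offset, the sums over an orbit do not depend on \<open>d\<close> and \<open>e\<close>, which makes both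
  statistics homometric. A homomesic statistic would be three times as large on the long orbit as
  on a short one, which would mean \<open>3 k = 5\<close> for \<open>chi\<close> and \<open>3 k = 1\<close> for \<open>chi_hat\<close>.
\<close>

section \<open>Cyclic sequences and their orbits\<close>

lemma funpow_cyclic:
  assumes "\<And>t. t < n \<Longrightarrow> f (g t) = g (Suc t mod n)" "t < n"
  shows "(f ^^ j) (g t) = g ((t + j) mod n)"
proof (induction j)
  case (Suc j)
  then show ?case
    using assms by (simp add: mod_Suc_eq)
qed (use assms in simp)

text \<open>
  The starting point \<open>g t\<close> is an arbitrary member of the cycle, because an antichain can occur
  anywhere in the sequence that describes its orbit.
\<close>

lemma orbit_cyclic:
  assumes step: "\<And>t. t < n \<Longrightarrow> f (g t) = g (Suc t mod n)" and t: "t < n"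
  shows "orbit f (g t) = g ` {..<n}"
proof
  show "orbit f (g t) \<subseteq> g ` {..<n}"
    using t by (auto simp: orbit_altdef funpow_cyclic[where f = f and g = g, OF step t])
  show "g ` {..<n} \<subseteq> orbit f (g t)"
  proof
    fix x assume "x \<in> g ` {..<n}"
    then obtain s where s: "s < n" "x = g s"
      by auto
    \<comment> \<open>One full turn is added so that the number of steps is positive even for \<open>s \<le> t\<close>.\<close>
    define j where "j = n - t + s"
    have "(t + j) mod n = s" "0 < j"
      using s t by (auto simp: j_def)
    then have "x = (f ^^ j) (g t)"
      using s funpow_cyclic[where f = f and g = g, OF step t, of j] by simp
    then show "x \<in> orbit f (g t)"
      unfolding orbit_altdef using \<open>0 < j\<close> by blast
  qed
qed

lemma sum_shift_mod:
  fixes f :: "nat \<Rightarrow> 'a::comm_monoid_add"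
  shows "(\<Sum>t<k. f ((t + e) mod k)) = (\<Sum>t<k. f t)"
proof (cases "k = 0")
  case False
  have "inj_on (\<lambda>t. (t + e) mod k) {..<k}"
  proof (rule inj_onI)
    fix s t assume "s \<in> {..<k}" "t \<in> {..<k}" "(s + e) mod k = (t + e) mod k"
    then have "[s + e = t + e] (mod k)" "s < k" "t < k" by (auto simp: cong_def)
    then show "s = t"
      by (simp add: cong_add_rcancel_nat cong_less_modulus_unique_nat)
  qed
  moreover have "(\<lambda>t. (t + e) mod k) ` {..<k} \<subseteq> {..<k}"
    using False by auto
  ultimately have "bij_betw (\<lambda>t. (t + e) mod k) {..<k} {..<k}"
    by (simp add: bij_betw_def endo_inj_surj)
  then show ?thesis
    by (rule sum.reindex_bij_betw)
qed simp

section \<open>Coordinates for antichains of the tree\<close>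

text \<open>
  Positions are counted from \<open>1\<close>, and \<open>0\<close> means that the antichain misses the chain. In this way
  one step of rowmotion adds \<open>1\<close> to a coordinate, and in a branch the coordinate is also the number
  of elements of that branch in the generated ideal.
\<close>

definition config :: "nat \<Rightarrow> nat \<Rightarrow> nat \<Rightarrow> nat \<Rightarrow> nat \<Rightarrow> node set" where
  "config p q a b c = B123 ` {i. Suc i = p} \<union> B12 ` {i. Suc i = q} \<union>
     B1 ` {i. Suc i = a} \<union> B2 ` {i. Suc i = b} \<union> B3 ` {i. Suc i = c}"

lemma mem_config [simp]:
  "B123 i \<in> config p q a b c \<longleftrightarrow> p = Suc i" "B12 i \<in> config p q a b c \<longleftrightarrow> q = Suc i"
  "B1 i \<in> config p q a b c \<longleftrightarrow> a = Suc i" "B2 i \<in> config p q a b c \<longleftrightarrow> b = Suc i"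
  "B3 i \<in> config p q a b c \<longleftrightarrow> c = Suc i"
  by (auto simp: config_def)

lemma config_eq_iff [simp]:
  "config p q a b c = config p' q' a' b' c' \<longleftrightarrow> p = p' \<and> q = q' \<and> a = a' \<and> b = b' \<and> c = c'"
proof
  assume eq: "config p q a b c = config p' q' a' b' c'"
  have "m = n" if "\<And>i. m = Suc i \<longleftrightarrow> n = Suc i" for m n :: nat
    using that by (metis not0_implies_Suc)
  then show "p = p' \<and> q = q' \<and> a = a' \<and> b = b' \<and> c = c'"
    by (metis eq mem_config)
qed auto

lemma set_eq_config_iff:
  "A = config p q a b c \<longleftrightarrow> (\<forall>i. (B123 i \<in> A \<longleftrightarrow> p = Suc i) \<and> (B12 i \<in> A \<longleftrightarrow> q = Suc i) \<and>
     (B1 i \<in> A \<longleftrightarrow> a = Suc i) \<and> (B2 i \<in> A \<longleftrightarrow> b = Suc i) \<and> (B3 i \<in> A \<longleftrightarrow> c = Suc i))"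
    (is "_ \<longleftrightarrow> ?R")
proof
  assume R: ?R
  show "A = config p q a b c"
  proof (rule set_eqI)
    show "x \<in> A \<longleftrightarrow> x \<in> config p q a b c" for x
      using R by (cases x) auto
  qed
qed simp

lemma bex_config:
  "(\<exists>y\<in>config p q a b c. Q y) \<longleftrightarrow>
     (0 < p \<and> Q (B123 (p - 1))) \<or> (0 < q \<and> Q (B12 (q - 1))) \<or>
     (0 < a \<and> Q (B1 (a - 1))) \<or> (0 < b \<and> Q (B2 (b - 1))) \<or> (0 < c \<and> Q (B3 (c - 1)))"
proof -
  have *: "(\<exists>y\<in>h ` {i. Suc i = n}. Q y) \<longleftrightarrow> 0 < n \<and> Q (h (n - 1))" for h :: "nat \<Rightarrow> node" and n
    by (cases n) auto
  show ?thesis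
    unfolding config_def bex_Un * by blast
qed

lemma card_config:
  "card (config p q a b c) =
     of_bool (0 < p) + of_bool (0 < q) + of_bool (0 < a) + of_bool (0 < b) + of_bool (0 < c)"
proof -
  have *: "{i. Suc i = n} = (if n = 0 then {} else {n - 1})" for n
    by auto
  show ?thesis
    unfolding config_def * by (auto simp: card_insert_if)
qed

lemma mem_down_config:
  assumes "p \<le> k" "q \<le> k" "a < k" "b < k" "c < k"
  shows
    "B123 i \<in> down (tree k) (tree_order k) (config p q a b c) \<longleftrightarrow>
       i < k \<and> (i < p \<or> 0 < q \<or> 0 < a \<or> 0 < b \<or> 0 < c)"
    "B12 i \<in> down (tree k) (tree_order k) (config p q a b c) \<longleftrightarrow> i < k \<and> (i < q \<or> 0 < a \<or> 0 < b)"
    "B1 i \<in> down (tree k) (tree_order k) (config p q a b c) \<longleftrightarrow> i < a"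
    "B2 i \<in> down (tree k) (tree_order k) (config p q a b c) \<longleftrightarrow> i < b"
    "B3 i \<in> down (tree k) (tree_order k) (config p q a b c) \<longleftrightarrow> i < c"
  using assms by (auto simp: down_def tree_order_def bex_config)

lemma card_five_chains:
  "card (B123 ` {..<p} \<union> B12 ` {..<q} \<union> B1 ` {..<a} \<union> B2 ` {..<b} \<union> B3 ` {..<c}) =
     p + q + a + b + c"
  by (subst card_Un_disjoint; (auto simp: card_image inj_on_def)?)+

text \<open>
  The generated ideal contains the whole trunk as soon as the antichain meets any other chain, and
  all of \<open>B12\<close> as soon as it meets \<open>B1\<close> or \<open>B2\<close>; hence the conditionals.
\<close>

lemma down_config:
  assumes "p \<le> k" "q \<le> k" "a < k" "b < k" "c < k"
  defines "D \<equiv> down (tree k) (tree_order k) (config p q a b c)"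
  shows "D = B123 ` {..<if q = 0 \<and> a = 0 \<and> b = 0 \<and> c = 0 then p else k} \<union>
    B12 ` {..<if a = 0 \<and> b = 0 then q else k} \<union> B1 ` {..<a} \<union> B2 ` {..<b} \<union> B3 ` {..<c}"
    (is "_ = ?R")
proof (rule set_eqI)
  show "x \<in> D \<longleftrightarrow> x \<in> ?R" for x
    using assms(1-5) unfolding D_def by (cases x) (auto simp: mem_down_config)
qed

lemma card_down_config:
  assumes "p \<le> k" "q \<le> k" "a < k" "b < k" "c < k"
  shows "card (down (tree k) (tree_order k) (config p q a b c)) =
    (if q = 0 \<and> a = 0 \<and> b = 0 \<and> c = 0 then p else k) +
    (if a = 0 \<and> b = 0 then q else k) + a + b + c"
  unfolding down_config[OF assms] card_five_chains ..

section \<open>Rowmotion in coordinates\<close>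

text \<open>
  The complement of the ideal of \<open>A\<close> is closed upwards. If everything strictly below \<open>x\<close> lies below
  \<open>y\<close>, it is therefore enough to test the minimality of \<open>x\<close> in this complement at \<open>y\<close>.
\<close>

lemma rowmotion_iff_lower_cover:
  assumes po: "partial_order_on P r" and x: "x \<in> P" "(y, x) \<in> r" "y \<noteq> x"
    and below: "\<And>z. (z, x) \<in> r \<Longrightarrow> z \<noteq> x \<Longrightarrow> (z, y) \<in> r"
  shows "x \<in> rowmotion P r A \<longleftrightarrow> x \<notin> down P r A \<and> y \<in> down P r A"
proof -
  have tr: "trans r" and sub: "r \<subseteq> P \<times> P"
    using po by (auto simp: partial_order_on_def preorder_on_def)
  have "z \<in> down P r A" if "(z, x) \<in> r" "z \<noteq> x" "y \<in> down P r A" for z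
    using below[OF that(1,2)] that(3) tr sub unfolding down_def trans_def by blast
  then show ?thesis
    using x sub unfolding rowmotion_def minimals_def by blast
qed

text \<open>
  In a tree every element except the root has exactly one lower cover, so membership in the image
  of rowmotion is decided by two membership tests in the ideal.
\<close>

lemma mem_rowmotion_tree:
  fixes A
  assumes k: "k \<ge> 2"
  defines "R \<equiv> rowmotion (tree k) (tree_order k) A" and "D \<equiv> down (tree k) (tree_order k) A"
  shows
    "B123 i \<in> R \<longleftrightarrow> i < k \<and> B123 i \<notin> D \<and> (i = 0 \<or> B123 (i - 1) \<in> D)"
    "B12 i \<in> R \<longleftrightarrow> i < k \<and> B12 i \<notin> D \<and> (if i = 0 then B123 (k - 1) else B12 (i - 1)) \<in> D"
    "B1 i \<in> R \<longleftrightarrow> i < k - 1 \<and> B1 i \<notin> D \<and> (if i = 0 then B12 (k - 1) else B1 (i - 1)) \<in> D"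
    "B2 i \<in> R \<longleftrightarrow> i < k - 1 \<and> B2 i \<notin> D \<and> (if i = 0 then B12 (k - 1) else B2 (i - 1)) \<in> D"
    "B3 i \<in> R \<longleftrightarrow> i < k - 1 \<and> B3 i \<notin> D \<and> (if i = 0 then B123 (k - 1) else B3 (i - 1)) \<in> D"
proof -
  have outside: "x \<notin> R" if "x \<notin> tree k" for x
    using that by (auto simp: R_def rowmotion_def minimals_def)
  have cover: "x \<in> R \<longleftrightarrow> x \<notin> D \<and> y \<in> D"
    if "x \<in> tree k" "y \<in> tree k" "node_le y x" "y \<noteq> x"
      "\<And>z. z \<in> tree k \<Longrightarrow> node_le z x \<Longrightarrow> z \<noteq> x \<Longrightarrow> node_le z y" for x y
    unfolding R_def D_def
    by (rule rowmotion_iff_lower_cover[OF partial_order_on_tree]) (use that in \<open>auto simp: tree_order_def\<close>)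
  have root: "B123 0 \<in> R \<longleftrightarrow> B123 0 \<notin> D"
  proof -
    have "y = B123 0" if "(y, B123 0) \<in> tree_order k" for y
      using that by (cases y) (auto simp: tree_order_def)
    then show ?thesis
      using k by (auto simp: R_def D_def rowmotion_def minimals_def)
  qed
  show "B123 i \<in> R \<longleftrightarrow> i < k \<and> B123 i \<notin> D \<and> (i = 0 \<or> B123 (i - 1) \<in> D)"
  proof (cases "i < k \<and> i > 0")
    case True
    then have "node_le z (B123 (i - 1))" if "node_le z (B123 i)" "z \<noteq> B123 i" for z
      using that by (cases z) auto
    then show ?thesis
      using True by (subst cover[of _ "B123 (i - 1)"]) auto
  qed (use outside root k in auto)
  show "B12 i \<in> R \<longleftrightarrow> i < k \<and> B12 i \<notin> D \<and> (if i = 0 then B123 (k - 1) else B12 (i - 1)) \<in> D"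
  proof (cases "i < k")
    case True
    let ?y = "if i = 0 then B123 (k - 1) else B12 (i - 1)"
    have "node_le z ?y" if "z \<in> tree k" "node_le z (B12 i)" "z \<noteq> B12 i" for z
      using that k by (cases z) auto
    then show ?thesis
      using True k by (subst cover[of _ ?y]) auto
  qed (use outside in auto)
  show "B1 i \<in> R \<longleftrightarrow> i < k - 1 \<and> B1 i \<notin> D \<and> (if i = 0 then B12 (k - 1) else B1 (i - 1)) \<in> D"
  proof (cases "i < k - 1")
    case True
    let ?y = "if i = 0 then B12 (k - 1) else B1 (i - 1)"
    have "node_le z ?y" if "z \<in> tree k" "node_le z (B1 i)" "z \<noteq> B1 i" for z
      using that k by (cases z) auto
    then show ?thesis
      using True k by (subst cover[of _ ?y]) auto
  qed (use outside in auto)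
  show "B2 i \<in> R \<longleftrightarrow> i < k - 1 \<and> B2 i \<notin> D \<and> (if i = 0 then B12 (k - 1) else B2 (i - 1)) \<in> D"
  proof (cases "i < k - 1")
    case True
    let ?y = "if i = 0 then B12 (k - 1) else B2 (i - 1)"
    have "node_le z ?y" if "z \<in> tree k" "node_le z (B2 i)" "z \<noteq> B2 i" for z
      using that k by (cases z) auto
    then show ?thesis
      using True k by (subst cover[of _ ?y]) auto
  qed (use outside in auto)
  show "B3 i \<in> R \<longleftrightarrow> i < k - 1 \<and> B3 i \<notin> D \<and> (if i = 0 then B123 (k - 1) else B3 (i - 1)) \<in> D"
  proof (cases "i < k - 1")
    case True
    let ?y = "if i = 0 then B123 (k - 1) else B3 (i - 1)"
    have "node_le z ?y" if "z \<in> tree k" "node_le z (B3 i)" "z \<noteq> B3 i" for z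
      using that k by (cases z) auto
    then show ?thesis
      using True k by (subst cover[of _ ?y]) auto
  qed (use outside in auto)
qed

lemma rowmotion_trunk:
  assumes "k \<ge> 2" "p < k"
  shows "rowmotion (tree k) (tree_order k) (config p 0 0 0 0) = config (Suc p) 0 0 0 0"
  using assms unfolding set_eq_config_iff by (auto simp: mem_rowmotion_tree mem_down_config)

lemma rowmotion_trunk_top:
  assumes "k \<ge> 2"
  shows "rowmotion (tree k) (tree_order k) (config k 0 0 0 0) = config 0 1 0 0 1"
  using assms unfolding set_eq_config_iff by (auto simp: mem_rowmotion_tree mem_down_config)

text \<open>
  The hypothesis \<open>0 < q \<or> 0 < c\<close> excludes the empty antichain, whose image is the root. Otherwise
  the trunk is full and stays full, because \<open>B12\<close> can still be extended; hence \<open>B3\<close> restarts at \<open>0\<close>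
  when it is full.
\<close>

lemma rowmotion_fork:
  assumes "k \<ge> 2" "q < k" "c < k" "0 < q \<or> 0 < c"
  shows "rowmotion (tree k) (tree_order k) (config 0 q 0 0 c) = config 0 (Suc q) 0 0 (Suc c mod k)"
  using assms unfolding set_eq_config_iff
  by (auto simp: mem_rowmotion_tree mem_down_config mod_Suc)

lemma rowmotion_fork_top:
  assumes "k \<ge> 2" "c < k"
  shows "rowmotion (tree k) (tree_order k) (config 0 k 0 0 c) = config 0 0 1 1 (Suc c mod k)"
  using assms unfolding set_eq_config_iff
  by (auto simp: mem_rowmotion_tree mem_down_config mod_Suc)

text \<open>
  This rule includes the collapses: if \<open>B1\<close> and \<open>B2\<close> are both full, both coordinates become \<open>0\<close>, and
  the coordinate \<open>0\<close> of \<open>B12\<close> now means that \<open>B12\<close> is empty instead of hidden below a branch. If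
  \<open>B3\<close> is full as well, the image is the empty antichain.
\<close>

lemma rowmotion_branches:
  assumes "k \<ge> 2" "a < k" "b < k" "c < k" "0 < a \<or> 0 < b"
  shows "rowmotion (tree k) (tree_order k) (config 0 0 a b c) =
    config 0 0 (Suc a mod k) (Suc b mod k) (Suc c mod k)"
  using assms unfolding set_eq_config_iff
  by (auto simp: mem_rowmotion_tree mem_down_config mod_Suc)

section \<open>The three families of orbits\<close>

definition short :: "nat \<Rightarrow> nat \<Rightarrow> nat \<Rightarrow> nat \<Rightarrow> node set" where
  "short k d e t = config 0 0 (t mod k) ((t + d) mod k) ((t + e) mod k)"

text \<open>
  For \<open>t \<le> k\<close> the chain \<open>B12\<close> is being filled, and the truncated difference \<open>t - k\<close> keeps its two
  branches empty. For \<open>t > k\<close> the two branches are filled simultaneously.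
\<close>

definition medium :: "nat \<Rightarrow> nat \<Rightarrow> nat \<Rightarrow> node set" where
  "medium k e t = config 0 (if t \<le> k then t else 0) (t - k) (t - k) ((t + e) mod k)"

text \<open>
  After the trunk is filled, the sequence continues like a medium one with offset \<open>0\<close>. The two
  differ at the junction: \<open>medium k 0 0\<close> is the empty antichain, whereas \<open>long k k\<close> is the top of the
  trunk.
\<close>

definition long :: "nat \<Rightarrow> nat \<Rightarrow> node set" where
  "long k t = (if t \<le> k then config t 0 0 0 0 else medium k 0 (t - k))"

lemma rowmotion_short:
  assumes "k \<ge> 2" "0 < d" "d < k" "t < k"
  shows "rowmotion (tree k) (tree_order k) (short k d e t) = short k d e (Suc t mod k)"
proof -
  \<comment> \<open>The offset \<open>d\<close> keeps the branches \<open>B1\<close> and \<open>B2\<close> from being empty at the same time.\<close>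
  have "0 < t mod k \<or> 0 < (t + d) mod k"
    using assms by (cases "t = 0") auto
  then show ?thesis
    using assms by (simp add: short_def rowmotion_branches mod_Suc_eq mod_add_left_eq)
qed

text \<open>
  The hypothesis \<open>0 < t \<or> 0 < e\<close> leaves out only \<open>medium k 0 0\<close>, so that the case \<open>e = 0\<close> can describe
  the last two thirds of the long orbit.
\<close>

lemma rowmotion_medium:
  assumes "k \<ge> 2" "e < k" "t < 2 * k" "0 < t \<or> 0 < e"
  shows "rowmotion (tree k) (tree_order k) (medium k e t) = medium k e (Suc t mod (2 * k))"
proof -
  consider "t < k" | "t = k" | "k < t" "Suc t < 2 * k" | "Suc t = 2 * k"
    using assms by linarith
  then show ?thesis
  proof cases
    case 1
    have "0 < t \<or> 0 < (t + e) mod k"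
      using assms by (cases "t = 0") auto
    then show ?thesis
      using 1 assms by (simp add: medium_def rowmotion_fork mod_Suc_eq)
  next
    case 2
    have "Suc (k + e) mod k = Suc e mod k"
      by (metis add_Suc_right mod_add_self1)
    then show ?thesis
      using 2 assms by (simp add: medium_def rowmotion_fork_top mod_Suc_eq)
  next
    case 3
    then have "Suc (t - k) mod k = Suc t - k"
      by (simp add: Suc_diff_le)
    then show ?thesis
      using 3 assms by (simp add: medium_def rowmotion_branches mod_Suc_eq)
  next
    case 4
    then have "Suc (t - k) = k" "Suc (t + e) = k + (k + e)"
      by auto
    then have "Suc (t - k) mod k = 0" "Suc (t + e) mod k = e mod k"
      by (simp_all only: mod_self mod_add_self1)
    then show ?thesis
      using 4 assms by (simp add: medium_def rowmotion_branches mod_Suc_eq)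
  qed
qed

lemma rowmotion_long:
  assumes "k \<ge> 2" "t < 3 * k"
  shows "rowmotion (tree k) (tree_order k) (long k t) = long k (Suc t mod (3 * k))"
proof -
  consider "t < k" | "t = k" | "k < t" "Suc t < 3 * k" | "Suc t = 3 * k"
    using assms by linarith
  then show ?thesis
  proof cases
    case 1
    then show ?thesis
      using assms by (simp add: long_def rowmotion_trunk)
  next
    case 2
    then show ?thesis
      using assms by (simp add: long_def medium_def rowmotion_trunk_top)
  next
    case 3
    then show ?thesis
      using assms by (simp add: long_def rowmotion_medium Suc_diff_le)
  next
    case 4
    then have "Suc (t - k) = 2 * k" "k < t"
      using assms by auto
    moreover have "rowmotion (tree k) (tree_order k) (medium k 0 (t - k)) =
        medium k 0 (Suc (t - k) mod (2 * k))"
      by (rule rowmotion_medium) (use assms \<open>k < t\<close> in auto)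
    ultimately have "rowmotion (tree k) (tree_order k) (long k t) = medium k 0 0"
      by (simp add: long_def)
    then show ?thesis
      using 4 by (simp add: long_def medium_def)
  qed
qed

lemma inj_short: "inj_on (short k d e) {..<k}"
  by (auto simp: inj_on_def short_def)

lemma inj_medium: "inj_on (medium k e) {..<2 * k}"
  by (auto simp: inj_on_def medium_def split: if_splits)

lemma inj_long: "inj_on (long k) {..<3 * k}"
  by (auto simp: inj_on_def long_def medium_def split: if_splits)

section \<open>Every antichain lies in one of the families\<close>

text \<open>
  Two elements of a chain are comparable, so an antichain meets the chain at most once.
\<close>

lemma chain_coordinate:
  assumes "\<And>i j. h i \<in> A \<Longrightarrow> h j \<in> A \<Longrightarrow> i \<le> j \<Longrightarrow> i = j" "\<And>i. h i \<in> A \<Longrightarrow> i < m"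
  obtains n where "\<And>i. h i \<in> A \<longleftrightarrow> n = Suc i" "n \<le> m"
proof (cases "\<exists>i. h i \<in> A")
  case True
  then obtain i where "h i \<in> A" ..
  then show thesis
    using that[of "Suc i"] assms by (metis Suc_inject Suc_leI nat_le_linear)
qed (use that[of 0] in auto)

lemma antichain_is_config:
  assumes A: "A \<in> antichains (tree k) (tree_order k)" and "k \<ge> 2"
  obtains p q a b c where "A = config p q a b c" "p \<le> k" "q \<le> k" "a < k" "b < k" "c < k"
    "0 < p \<Longrightarrow> q = 0 \<and> a = 0 \<and> b = 0 \<and> c = 0" "0 < q \<Longrightarrow> a = 0 \<and> b = 0"
proof -
  have anti: "x = y" if "x \<in> A" "y \<in> A" "node_le x y" for x y
    using A that by (auto simp: antichains_def tree_order_def)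
  have sub: "x \<in> tree k" if "x \<in> A" for x
    using A that by (auto simp: antichains_def)
  obtain p where p: "\<And>i. B123 i \<in> A \<longleftrightarrow> p = Suc i" "p \<le> k"
    by (rule chain_coordinate[of B123 A k]) (use anti sub in force)+
  obtain q where q: "\<And>i. B12 i \<in> A \<longleftrightarrow> q = Suc i" "q \<le> k"
    by (rule chain_coordinate[of B12 A k]) (use anti sub in force)+
  obtain a where a: "\<And>i. B1 i \<in> A \<longleftrightarrow> a = Suc i" "a \<le> k - 1"
    by (rule chain_coordinate[of B1 A "k - 1"]) (use anti sub in force)+
  obtain b where b: "\<And>i. B2 i \<in> A \<longleftrightarrow> b = Suc i" "b \<le> k - 1"
    by (rule chain_coordinate[of B2 A "k - 1"]) (use anti sub in force)+
  obtain c where c: "\<And>i. B3 i \<in> A \<longleftrightarrow> c = Suc i" "c \<le> k - 1"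
    by (rule chain_coordinate[of B3 A "k - 1"]) (use anti sub in force)+
  have "A = config p q a b c"
    unfolding set_eq_config_iff using p q a b c by blast
  moreover have "q = 0 \<and> a = 0 \<and> b = 0 \<and> c = 0" if "0 < p"
  proof -
    have "B123 (p - 1) \<in> A"
      using that p(1)[of "p - 1"] by simp
    then have "B12 i \<notin> A" "B1 i \<notin> A" "B2 i \<notin> A" "B3 i \<notin> A" for i
      using anti[of "B123 (p - 1)"] by fastforce+
    then show ?thesis
      using q(1) a(1) b(1) c(1) by (metis not0_implies_Suc)
  qed
  moreover have "a = 0 \<and> b = 0" if "0 < q"
  proof -
    have "B12 (q - 1) \<in> A"
      using that q(1)[of "q - 1"] by simp
    then have "B1 i \<notin> A" "B2 i \<notin> A" for i
      using anti[of "B12 (q - 1)"] by fastforce+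
    then show ?thesis
      using a(1) b(1) by (metis not0_implies_Suc)
  qed
  ultimately show thesis
    using that p q a b c \<open>k \<ge> 2\<close> by auto
qed

lemma offset_exists:
  assumes "c < (k::nat)"
  obtains e where "e < k" "(t + e) mod k = c"
proof
  have "t mod k < k" "t mod k \<le> t"
    using assms by auto
  then have "t + (c + (k - t mod k)) = c + k + (t - t mod k)"
    by linarith
  also have "t - t mod k = k * (t div k)"
    by (simp add: minus_mod_eq_mult_div)
  finally show "(t + (c + (k - t mod k)) mod k) mod k = c"
    using assms by (simp add: mod_add_right_eq)
qed (use assms in simp)

text \<open>
  The coordinates of the branches, read as residues, give the offsets. If \<open>a \<noteq> b\<close>, the antichain is
  at time \<open>a\<close> of a short sequence. If \<open>a = b\<close> and the antichain avoids the trunk, it is at time \<open>q\<close>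
  (while \<open>B12\<close> is being filled) or \<open>k + a\<close> of a medium sequence with some offset \<open>e\<close>, and \<open>e = 0\<close> is
  part of the long sequence.
\<close>

lemma antichain_cases:
  assumes A: "A \<in> antichains (tree k) (tree_order k)" and k: "k \<ge> 2"
  obtains (short) d e t where "0 < d" "d < k" "e < k" "t < k" "A = short k d e t"
  | (medium) e t where "0 < e" "e < k" "t < 2 * k" "A = medium k e t"
  | (long) t where "t < 3 * k" "A = long k t"
proof -
  have medium_or_long: thesis if e: "e < k" and t: "t < 2 * k" and eq: "A = medium k e t" for e t
  proof (cases "e = 0")
    case True
    \<comment> \<open>For \<open>t = 0\<close> the antichain is empty and belongs to the start of the long sequence.\<close>
    have "A = long k (if t = 0 then 0 else k + t)"
      using True eq by (auto simp: long_def medium_def)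
    moreover have "(if t = 0 then 0 else k + t) < 3 * k"
      using t by auto
    ultimately show ?thesis
      by (rule long[rotated])
  qed (use that medium in blast)
  obtain p q a b c where C: "A = config p q a b c" "p \<le> k" "q \<le> k" "a < k" "b < k" "c < k"
    "0 < p \<Longrightarrow> q = 0 \<and> a = 0 \<and> b = 0 \<and> c = 0" "0 < q \<Longrightarrow> a = 0 \<and> b = 0"
    using antichain_is_config[OF A k] by blast
  show thesis
  proof (cases "0 < p")
    case True
    then have "A = long k p" "p < 3 * k"
      using C k by (auto simp: long_def)
    then show ?thesis
      by (rule long[rotated])
  next
    case p: False
    show ?thesis
    proof (cases "a = b")
      case False
      obtain d where d: "d < k" "(a + d) mod k = b"
        using offset_exists[OF \<open>b < k\<close>] .
      obtain e where e: "e < k" "(a + e) mod k = c"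
        using offset_exists[OF \<open>c < k\<close>] .
      have "q = 0"
        using C(8) False by auto
      have "0 < d"
        using d False C by (cases d) auto
      moreover have "A = short k d e a"
        using C(1,4) p d e \<open>q = 0\<close> by (simp add: short_def)
      ultimately show ?thesis
        using short d e C by blast
    next
      case True
      define t where "t = (if a = 0 then q else k + a)"
      obtain e where e: "e < k" "(t + e) mod k = c"
        using offset_exists[OF \<open>c < k\<close>] .
      have "A = medium k e t"
        using C p e True by (auto simp: medium_def t_def)
      moreover have "t < 2 * k"
        using C k by (auto simp: t_def)
      ultimately show ?thesis
        using medium_or_long e by blast
    qed
  qed
qed

section \<open>Summing over the orbits\<close>

lemma chi_image: "inj_on g {..<n} \<Longrightarrow> chi (g ` {..<n}) = (\<Sum>t<n. real (card (g t)))"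
  by (simp add: chi_def sum.reindex)

lemma chi_hat_image:
  "inj_on g {..<n} \<Longrightarrow> chi_hat P r (g ` {..<n}) = (\<Sum>t<n. real (card (down P r (g t))))"
  by (simp add: chi_hat_def sum.reindex)

lemma sum_concat:
  fixes f :: "nat \<Rightarrow> 'a::comm_monoid_add"
  shows "(\<Sum>t<m + n. f t) = (\<Sum>t<m. f t) + (\<Sum>t<n. f (m + t))"
  by (induction n) (simp_all add: add.assoc)

lemma sum_lessThan_id: "(\<Sum>t<k. real t) = real k * (real k - 1) / 2"
  by (induction k) (simp_all add: field_simps)

lemma sum_positive: "0 < k \<Longrightarrow> (\<Sum>t<k. of_bool (0 < t) :: real) = real k - 1"
  by (induction k) (auto simp: of_bool_def)

lemma card_medium:
  "card (medium k e t) = of_bool (0 < t) + of_bool (k < t) + of_bool (0 < (t + e) mod k)"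
  by (auto simp: medium_def card_config)

text \<open>
  The formula is not valid for \<open>t = e = 0\<close>, where the ideal is empty; it gives \<open>k\<close> there, which is the
  size of the ideal at the corresponding time \<open>k\<close> of the long sequence.
\<close>

lemma card_down_medium:
  assumes "t < 2 * k" "0 < t \<or> 0 < e" "e < k"
  shows "card (down (tree k) (tree_order k) (medium k e t)) = k + t + (t - k) + (t + e) mod k"
proof (cases "t = 0")
  case True
  then show ?thesis
    using assms by (simp add: medium_def card_down_config)
next
  case False
  then show ?thesis
    unfolding medium_def using assms by (subst card_down_config) auto
qed

lemma chi_short:
  assumes "0 < k"
  shows "chi (short k d e ` {..<k}) = 3 * real k - 3"
proof -
  have "chi (short k d e ` {..<k}) =
      (\<Sum>t<k. of_bool (0 < t mod k) + of_bool (0 < (t + d) mod k) + of_bool (0 < (t + e) mod k))"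
    unfolding chi_image[OF inj_short] by (simp add: short_def card_config)
  also have "\<dots> = 3 * (\<Sum>t<k. of_bool (0 < t))"
    using sum_shift_mod[of "\<lambda>t. of_bool (0 < t) :: real" _ k] by (simp add: sum.distrib)
  finally show ?thesis
    unfolding sum_positive[OF assms] by simp
qed

lemma chi_hat_short:
  assumes "0 < d" "d < k"
  shows "chi_hat (tree k) (tree_order k) (short k d e ` {..<k}) =
    7 / 2 * (real k)^2 - 3 / 2 * real k"
proof -
  have "chi_hat (tree k) (tree_order k) (short k d e ` {..<k}) =
      (\<Sum>t<k. 2 * real k + real t + real ((t + d) mod k) + real ((t + e) mod k))"
    unfolding chi_hat_image[OF inj_short]
  proof (rule sum.cong)
    fix t assume "t \<in> {..<k}"
    then show "real (card (down (tree k) (tree_order k) (short k d e t))) =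
        2 * real k + real t + real ((t + d) mod k) + real ((t + e) mod k)"
      unfolding short_def using assms by (cases "t = 0") (simp_all add: card_down_config)
  qed simp
  also have "\<dots> = 2 * (real k)^2 + 3 * (\<Sum>t<k. real t)"
    using sum_shift_mod[of real _ k] by (simp add: sum.distrib power2_eq_square)
  finally show ?thesis
    by (simp add: sum_lessThan_id field_simps power2_eq_square)
qed

lemma sum_card_medium:
  assumes "0 < k"
  shows "(\<Sum>t<2 * k. real (card (medium k e t))) = 5 * real k - 4"
proof -
  have "(\<Sum>t<k + k. real (card (medium k e t))) =
      (\<Sum>t<k. of_bool (0 < t) + of_bool (0 < (t + e) mod k)) +
      (\<Sum>t<k. 1 + of_bool (0 < t) + of_bool (0 < (t + e) mod k))"
    unfolding sum_concat using assms by (simp add: card_medium add.assoc)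
  then show ?thesis
    unfolding mult_2 sum.distrib sum_shift_mod[of "\<lambda>t. of_bool (0 < t) :: real" e k]
      sum_positive[OF assms]
    by simp
qed

lemma sum_medium_ideal_size:
  "(\<Sum>t<2 * k. real (k + t + (t - k) + (t + e) mod k)) = 11 / 2 * (real k)^2 - 5 / 2 * real k"
proof -
  have "(\<Sum>t<k + k. real (k + t + (t - k) + (t + e) mod k)) =
      (\<Sum>t<k. real k + real t + real ((t + e) mod k)) +
      (\<Sum>t<k. 2 * real k + 2 * real t + real ((t + e) mod k))"
    unfolding sum_concat by (simp add: add.assoc)
  also have "\<dots> = 3 * (real k)^2 + 5 * (\<Sum>t<k. real t)"
    using sum_shift_mod[of real e k]
    by (simp add: sum.distrib power2_eq_square flip: sum_distrib_left)
  finally show ?thesis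
    unfolding mult_2 by (simp add: sum_lessThan_id field_simps power2_eq_square)
qed

lemma chi_medium:
  assumes "0 < k"
  shows "chi (medium k e ` {..<2 * k}) = 5 * real k - 4"
  using assms by (simp add: chi_image[OF inj_medium] sum_card_medium)

lemma chi_hat_medium:
  assumes "0 < e" "e < k"
  shows "chi_hat (tree k) (tree_order k) (medium k e ` {..<2 * k}) =
    11 / 2 * (real k)^2 - 5 / 2 * real k"
proof -
  have "chi_hat (tree k) (tree_order k) (medium k e ` {..<2 * k}) =
      (\<Sum>t<2 * k. real (k + t + (t - k) + (t + e) mod k))"
    unfolding chi_hat_image[OF inj_medium]
    by (rule sum.cong) (use assms card_down_medium in auto)
  then show ?thesis
    unfolding sum_medium_ideal_size .
qed

lemma chi_long:
  assumes "0 < k"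
  shows "chi (long k ` {..<3 * k}) = 6 * real k - 4"
proof -
  have "chi (long k ` {..<3 * k}) = (\<Sum>t<k + 2 * k. real (card (long k t)))"
    by (simp add: chi_image[OF inj_long])
  \<comment> \<open>The extra \<open>1\<close> at \<open>t = 0\<close> is the top of the trunk, which replaces the empty antichain.\<close>
  also have "\<dots> = (\<Sum>t<k. of_bool (0 < t)) +
      (\<Sum>t<2 * k. real (card (medium k 0 t)) + (if t = 0 then 1 else 0))"
    unfolding sum_concat using assms
    by (intro arg_cong2[where f = "(+)"] sum.cong) (auto simp: long_def medium_def card_config)
  also have "\<dots> = (real k - 1) + (5 * real k - 4) + 1"
    unfolding sum.distrib sum_positive[OF assms] sum_card_medium[OF assms] using assms by simp
  finally show ?thesis
    by simp
qed

lemma chi_hat_long: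
  assumes "0 < k"
  shows "chi_hat (tree k) (tree_order k) (long k ` {..<3 * k}) = 6 * (real k)^2 - 3 * real k"
proof -
  let ?F = "\<lambda>t. real (card (down (tree k) (tree_order k) (long k t)))"
  have "chi_hat (tree k) (tree_order k) (long k ` {..<3 * k}) = (\<Sum>t<k + 2 * k. ?F t)"
    by (simp add: chi_hat_image[OF inj_long])
  also have "\<dots> = (\<Sum>t<k. ?F t) + (\<Sum>t<2 * k. ?F (k + t))"
    by (rule sum_concat)
  also have "(\<Sum>t<k. ?F t) = (\<Sum>t<k. real t)"
    by (intro sum.cong) (auto simp: long_def card_down_config)
  also have "(\<Sum>t<2 * k. ?F (k + t)) = (\<Sum>t<2 * k. real (k + t + (t - k) + (t + 0) mod k))"
  proof (intro sum.cong refl)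
    fix t assume "t \<in> {..<2 * k}"
    then show "?F (k + t) = real (k + t + (t - k) + (t + 0) mod k)"
      using assms card_down_medium[of t k 0]
      by (cases "t = 0") (auto simp: long_def card_down_config)
  qed
  finally show ?thesis
    unfolding sum_medium_ideal_size sum_lessThan_id by (simp add: field_simps power2_eq_square)
qed

section \<open>The orbits of the tree\<close>

definition short_orbits :: "nat \<Rightarrow> node set set set" where
  "short_orbits k = (\<lambda>(d, e). short k d e ` {..<k}) ` ({1..<k} \<times> {..<k})"

definition medium_orbits :: "nat \<Rightarrow> node set set set" where
  "medium_orbits k = (\<lambda>e. medium k e ` {..<2 * k}) ` {1..<k}"

definition long_orbits :: "nat \<Rightarrow> node set set set" where
  "long_orbits k = {long k ` {..<3 * k}}"

text \<open>
  The first term lies in the image of rowmotion, hence is an antichain, because the sequence is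
  cyclic.
\<close>

lemma cyclic_image_in_rowmotion_orbits:
  assumes step: "\<And>t. t < n \<Longrightarrow> rowmotion P r (g t) = g (Suc t mod n)" and "0 < n"
  shows "g ` {..<n} \<in> rowmotion_orbits P r"
proof -
  have "g 0 = rowmotion P r (g (n - 1))"
    using step[of "n - 1"] \<open>0 < n\<close> by simp
  then have "g 0 \<in> antichains P r"
    by (simp add: rowmotion_in_antichains)
  then show ?thesis
    unfolding rowmotion_orbits_def
    using orbit_cyclic[where f = "rowmotion P r" and g = g and t = 0, OF step \<open>0 < n\<close>]
    by (metis image_eqI)
qed

lemma rowmotion_orbits_tree:
  assumes k: "k \<ge> 2"
  shows "rowmotion_orbits (tree k) (tree_order k) =
    short_orbits k \<union> medium_orbits k \<union> long_orbits k" (is "?O = ?R")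
proof
  show "?O \<subseteq> ?R"
  proof
    fix X assume "X \<in> ?O"
    then obtain A where A: "A \<in> antichains (tree k) (tree_order k)"
      and X: "X = orbit (rowmotion (tree k) (tree_order k)) A"
      by (auto simp: rowmotion_orbits_def)
    from A k show "X \<in> ?R"
    proof (cases rule: antichain_cases)
      case (short d e t)
      have "X = short k d e ` {..<k}"
        unfolding X short(5) by (rule orbit_cyclic) (use short k rowmotion_short in auto)
      then show ?thesis
        using short by (force simp: short_orbits_def)
    next
      case (medium e t)
      have "X = medium k e ` {..<2 * k}"
        unfolding X medium(4) by (rule orbit_cyclic) (use medium k rowmotion_medium in auto)
      then show ?thesis
        using medium by (force simp: medium_orbits_def)
    next
      case (long t)
      have "X = long k ` {..<3 * k}"
        unfolding X long(2) by (rule orbit_cyclic) (use long k rowmotion_long in auto)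
      then show ?thesis
        by (simp add: long_orbits_def)
    qed
  qed
  have "short k d e ` {..<k} \<in> ?O" if "0 < d" "d < k" for d e
    by (rule cyclic_image_in_rowmotion_orbits) (use that k rowmotion_short in auto)
  moreover have "medium k e ` {..<2 * k} \<in> ?O" if "0 < e" "e < k" for e
    by (rule cyclic_image_in_rowmotion_orbits) (use that k rowmotion_medium in auto)
  moreover have "long k ` {..<3 * k} \<in> ?O"
    by (rule cyclic_image_in_rowmotion_orbits) (use k rowmotion_long in auto)
  ultimately show "?R \<subseteq> ?O"
    by (auto simp: short_orbits_def medium_orbits_def long_orbits_def)
qed

text \<open>
  The offsets can be recovered from an orbit: it has only one antichain that misses \<open>B1\<close>, namely the
  one at time \<open>0\<close>, whose coordinates in \<open>B2\<close> and \<open>B3\<close> are \<open>d\<close> and \<open>e\<close>.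
\<close>

lemma card_short_orbits: "card (short_orbits k) = k * (k - 1)"
proof -
  have "d = d' \<and> e = e'"
    if "d < k" "e < k" "d' < k" "e' < k" "short k d e ` {..<k} = short k d' e' ` {..<k}"
    for d e d' e'
  proof -
    have "short k d e 0 \<in> short k d' e' ` {..<k}"
      using that by (metis image_eqI lessThan_iff gr0I not_less0)
    then show ?thesis
      using that by (auto simp: short_def)
  qed
  then have "inj_on (\<lambda>(d, e). short k d e ` {..<k}) ({1..<k} \<times> {..<k})"
    by (auto simp: inj_on_def)
  then show ?thesis
    by (simp add: short_orbits_def card_image)
qed

text \<open>
  As before, the offset is the coordinate in \<open>B3\<close> at time \<open>0\<close>, which is the only time when the
  antichain misses the other chains.
\<close>

lemma card_medium_orbits: "card (medium_orbits k) = k - 1"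
proof -
  have "e = e'"
    if "e < k" "e' < k" "medium k e ` {..<2 * k} = medium k e' ` {..<2 * k}" for e e'
  proof -
    have "medium k e 0 \<in> medium k e' ` {..<2 * k}"
      using that by (metis image_eqI lessThan_iff gr0I not_less0 nat_0_less_mult_iff pos2)
    then show ?thesis
      using that by (auto simp: medium_def split: if_splits)
  qed
  then have "inj_on (\<lambda>e. medium k e ` {..<2 * k}) {1..<k}"
    by (auto simp: inj_on_def)
  then show ?thesis
    by (simp add: medium_orbits_def card_image)
qed

lemma homometric_by_length:
  assumes "\<And>X. X \<in> rowmotion_orbits P r \<Longrightarrow> st X = f (card X)"
  shows "homometric P r st"
  using assms by (simp add: homometric_def)

theorem theorem4p2:
  fixes k :: nat
  assumes "k \<ge> 2"
  shows "\<exists>\<S> \<M> \<L>.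
    \<S> \<union> \<M> \<union> \<L> = rowmotion_orbits (tree k) (tree_order k) \<and>
    \<S> \<inter> \<M> = {} \<and> \<S> \<inter> \<L> = {} \<and> \<M> \<inter> \<L> = {} \<and>
    (card \<S> = k * (k - 1) \<and> card \<M> = k - 1 \<and> card \<L> = 1 \<and>
     (\<forall>\<O>\<in>\<S>. card \<O> = k) \<and>
     (\<forall>\<O>\<in>\<M>. card \<O> = 2 * k) \<and>
     (\<forall>\<O>\<in>\<L>. card \<O> = 3 * k)) \<and>
    ((\<forall>\<O>\<in>\<S>. chi \<O> = 3 * real k - 3) \<and>
     (\<forall>\<O>\<in>\<M>. chi \<O> = 5 * real k - 4) \<and>
     (\<forall>\<O>\<in>\<L>. chi \<O> = 6 * real k - 4) \<and>
     homometric (tree k) (tree_order k) chi \<and>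
     \<not> homomesic (tree k) (tree_order k) chi) \<and>
    ((\<forall>\<O>\<in>\<S>. chi_hat (tree k) (tree_order k) \<O> = 7 / 2 * (real k)^2 - 3 / 2 * real k) \<and>
     (\<forall>\<O>\<in>\<M>. chi_hat (tree k) (tree_order k) \<O> = 11 / 2 * (real k)^2 - 5 / 2 * real k) \<and>
     (\<forall>\<O>\<in>\<L>. chi_hat (tree k) (tree_order k) \<O> = 6 * (real k)^2 - 3 * real k) \<and>
     homometric (tree k) (tree_order k) (chi_hat (tree k) (tree_order k)) \<and>
     \<not> homomesic (tree k) (tree_order k) (chi_hat (tree k) (tree_order k)))"
proof -
  let ?O = "rowmotion_orbits (tree k) (tree_order k)"
  let ?hat = "chi_hat (tree k) (tree_order k)"
  let ?S = "short_orbits k" and ?M = "medium_orbits k" and ?L = "long_orbits k"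
  have union: "?S \<union> ?M \<union> ?L = ?O"
    using rowmotion_orbits_tree[OF assms] by simp
  have S: "\<forall>X\<in>?S. card X = k" "\<forall>X\<in>?S. chi X = 3 * real k - 3"
    "\<forall>X\<in>?S. ?hat X = 7 / 2 * (real k)^2 - 3 / 2 * real k"
    using assms by (auto simp: short_orbits_def card_image[OF inj_short] chi_short chi_hat_short)
  have M: "\<forall>X\<in>?M. card X = 2 * k" "\<forall>X\<in>?M. chi X = 5 * real k - 4"
    "\<forall>X\<in>?M. ?hat X = 11 / 2 * (real k)^2 - 5 / 2 * real k"
    using assms
    by (auto simp: medium_orbits_def card_image[OF inj_medium] chi_medium chi_hat_medium)
  have L: "\<forall>X\<in>?L. card X = 3 * k" "\<forall>X\<in>?L. chi X = 6 * real k - 4"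
    "\<forall>X\<in>?L. ?hat X = 6 * (real k)^2 - 3 * real k"
    using assms by (auto simp: long_orbits_def card_image[OF inj_long] chi_long chi_hat_long)
  have disjoint: "?S \<inter> ?M = {}" "?S \<inter> ?L = {}" "?M \<inter> ?L = {}"
    using S(1) M(1) L(1) assms by fastforce+
  have card_orbits: "card ?S = k * (k - 1)" "card ?M = k - 1" "card ?L = 1"
    by (simp_all add: card_short_orbits card_medium_orbits long_orbits_def)
  have homometric: "homometric (tree k) (tree_order k) st"
    if st: "\<forall>X\<in>?S. st X = s" "\<forall>X\<in>?M. st X = m" "\<forall>X\<in>?L. st X = l" for st s m l
  proof (rule homometric_by_length[where f = "\<lambda>n. if n = k then s else if n = 2 * k then m else l"])
    fix X assume "X \<in> ?O"
    then consider "X \<in> ?S" | "X \<in> ?M" | "X \<in> ?L"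
      using union by blast
    then show "st X = (if card X = k then s else if card X = 2 * k then m else l)"
      using st S(1) M(1) L(1) assms by cases simp_all
  qed
  \<comment> \<open>The long orbit is three times as long as a short one; both kinds exist because \<open>k \<ge> 2\<close>.\<close>
  have not_homomesic: "\<not> homomesic (tree k) (tree_order k) st"
    if st: "\<forall>X\<in>?S. st X = s" "\<forall>X\<in>?L. st X = l" "3 * s \<noteq> l" for st s l
  proof
    assume "homomesic (tree k) (tree_order k) st"
    then obtain c where c: "\<forall>X\<in>?O. st X / real (card X) = c"
      by (auto simp: homomesic_def)
    have "short k 1 0 ` {..<k} \<in> ?S" "long k ` {..<3 * k} \<in> ?L"
      using assms by (force simp: short_orbits_def long_orbits_def)+
    then have "s / real k = c" "l / real (3 * k) = c"
      using c S(1) L(1) st(1,2) union by (metis UnI1, metis UnI2)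
    then show False
      using \<open>3 * s \<noteq> l\<close> assms by (simp add: field_simps)
  qed
  have chi_differs: "3 * (3 * real k - 3) \<noteq> 6 * real k - 4"
  proof
    assume "3 * (3 * real k - 3) = 6 * real k - 4"
    then have "real (3 * k) = real 5"
      by simp
    then have "3 * k = 5"
      by (simp only: of_nat_eq_iff)
    then show False
      by presburger
  qed
  have chi_hat_differs: "3 * (7 / 2 * (real k)^2 - 3 / 2 * real k) \<noteq> 6 * (real k)^2 - 3 * real k"
  proof
    assume "3 * (7 / 2 * (real k)^2 - 3 / 2 * real k) = 6 * (real k)^2 - 3 * real k"
    then have "real k * (3 * real k - 1) = 0"
      by (simp add: field_simps power2_eq_square)
    then show False
      using assms by simp
  qed
  show ?thesis
    by (intro exI[of _ ?S] exI[of _ ?M] exI[of _ ?L] conjI union disjoint card_orbits S M L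
        homometric[OF S(2) M(2) L(2)] homometric[OF S(3) M(3) L(3)]
        not_homomesic[OF S(2) L(2) chi_differs] not_homomesic[OF S(3) L(3) chi_hat_differs])
qed

end
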